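(* Let $A$ be a semisimple complex Banach algebra with identity and $\mathrm{Soc}\,A\neq\{0\}$. Then $\mathrm{Soc}\,A\subseteq Z(A)$ if and only if for all $x\in\mathrm{Soc}\,A$, $x^2=0$ implies $x=0$.
   Context: $Z(A)=\{x\in A: xy=yx\text{ for all }y\in A\}$ is the center of $A$. $\mathrm{Soc}\,A$ is the socle of $A$, the sum of all minimal left ideals of $A$ ($\{0\}$ if there are none). For semisimple $A$ it is a two-sided ideal and coincides with the set of finite-rank elements, i.e. those $a\in A$ with $\mathrm{rank}(a)=\sup_{x\in A}\#(\sigma(xa)\setminus\{0\})<\infty$, $\sigma$ denoting the spectrum. *)

theory Defs
  imports Complex_Main
begin

text \<open>The distribution only has real normed algebras; the complex scalars are added here.
  Neither commutativity nor \<open>norm 1 = 1\<close> is assumed.  Completeness comes from \<^class>\<open>banach\<close>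
  and submultiplicativity of the norm from \<^class>\<open>real_normed_algebra\<close>.\<close>

class complex_banach_algebra = banach + real_normed_algebra + ring_1 +
  fixes scaleC :: "complex \<Rightarrow> 'a \<Rightarrow> 'a"  (infixr "*\<^sub>C" 75)
  assumes scaleC_add_right: "c *\<^sub>C (x + y) = c *\<^sub>C x + c *\<^sub>C y"
    and scaleC_add_left: "(c + d) *\<^sub>C x = c *\<^sub>C x + d *\<^sub>C x"
    and scaleC_scaleC: "c *\<^sub>C d *\<^sub>C x = (c * d) *\<^sub>C x"
    and scaleC_one: "1 *\<^sub>C x = x"
    and scaleC_of_real: "complex_of_real r *\<^sub>C x = r *\<^sub>R x"
    and mult_scaleC_left: "(c *\<^sub>C x) * y = c *\<^sub>C (x * y)"
    and mult_scaleC_right: "x * (c *\<^sub>C y) = c *\<^sub>C (x * y)"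
    and norm_scaleC: "norm (c *\<^sub>C x) = cmod c * norm x"

global_interpretation complex_vector:
  vector_space "scaleC :: complex \<Rightarrow> 'a \<Rightarrow> 'a :: complex_banach_algebra"
  by unfold_locales (simp_all add: scaleC_add_right scaleC_add_left scaleC_scaleC scaleC_one)

definition algebra_center :: "'a::complex_banach_algebra set" where
  "algebra_center = {x. \<forall>y. x * y = y * x}"

definition left_ideal :: "'a::complex_banach_algebra set \<Rightarrow> bool" where
  "left_ideal L \<longleftrightarrow> complex_vector.subspace L \<and> (\<forall>a. \<forall>x\<in>L. a * x \<in> L)"

definition minimal_left_ideal :: "'a::complex_banach_algebra set \<Rightarrow> bool" where
  "minimal_left_ideal L \<longleftrightarrow> left_ideal L \<and> L \<noteq> {0} \<and>
     (\<forall>J. left_ideal J \<and> J \<subseteq> L \<longrightarrow> J = {0} \<or> J = L)"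

definition maximal_left_ideal :: "'a::complex_banach_algebra set \<Rightarrow> bool" where
  "maximal_left_ideal L \<longleftrightarrow> left_ideal L \<and> L \<noteq> UNIV \<and>
     (\<forall>J. left_ideal J \<and> L \<subseteq> J \<longrightarrow> J = L \<or> J = UNIV)"

definition jacobson_radical :: "'a::complex_banach_algebra set" where
  "jacobson_radical = \<Inter> {L. maximal_left_ideal L}"

definition semisimple :: "'a::complex_banach_algebra itself \<Rightarrow> bool" where
  "semisimple _ \<longleftrightarrow> (jacobson_radical :: 'a set) = {0}"

text \<open>The algebraic sum of all minimal left ideals: finite sums with one summand from each of
  finitely many of them.  The empty sum makes this \<open>{0}\<close> if there are none.\<close>

definition socle :: "'a::complex_banach_algebra set" where
  "socle = {\<Sum>L\<in>F. f L | F f. finite F \<and> (\<forall>L\<in>F. minimal_left_ideal L \<and> f L \<in> L)}"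

end

theory Submission
  imports Defs "HOL-Analysis.Analysis"
begin

text \<open>If the socle is central, a square-zero \<open>x\<close> in it satisfies \<open>x a x = 0\<close> for all \<open>a\<close>, and such
  elements lie in every maximal left ideal. Conversely, if the socle has no nonzero square-zero
  elements, every minimal left ideal is \<open>A e\<close> with \<open>e\<close> idempotent. The elements \<open>(1 - e) a e\<close>
  of \<open>A e\<close> are square-zero, hence vanish, and then the elements \<open>e a (1 - e)\<close> lie in the radical;
  so \<open>e\<close> is central. By minimality \<open>A e\<close> is a division algebra, so it equals \<open>\<complex> e\<close> by the
  Gelfand--Mazur theorem. The latter is shown by Rickart's elementary method, which averages the
  resolvent over roots of unity instead of appealing to Liouville's theorem.\<close>

section \<open>The Gelfand--Mazur theorem in a corner\<close>

text \<open>This is the average of \<open>G\<close> over the solutions \<open>z\<close> of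
  \<open>z ^ 2 ^ m = w\<close>, counted with multiplicity. Taking one square root at a time suits
  induction on \<open>m\<close>.\<close>

fun dyadic_mean :: "(complex \<Rightarrow> 'a::real_vector) \<Rightarrow> nat \<Rightarrow> complex \<Rightarrow> 'a" where
  "dyadic_mean G 0 w = G w"
| "dyadic_mean G (Suc m) w =
    (1/2) *\<^sub>R (dyadic_mean G m (csqrt w) + dyadic_mean G m (- csqrt w))"

lemma norm_half_sum_le:
  fixes a b :: "'a::real_normed_vector"
  assumes "norm a \<le> c" "norm b \<le> c"
  shows "norm ((1/2) *\<^sub>R (a + b)) \<le> c"
  using norm_triangle_ineq[of a b] assms by simp

lemma csqrt_mult_square:
  "csqrt (v * of_real (r ^ 2 ^ Suc m)) = csqrt v * of_real (r ^ 2 ^ m) \<or>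
   csqrt (v * of_real (r ^ 2 ^ Suc m)) = - (csqrt v * of_real (r ^ 2 ^ m))"
proof -
  have "(csqrt (v * of_real (r ^ 2 ^ Suc m)))\<^sup>2 = (csqrt v * of_real (r ^ 2 ^ m))\<^sup>2"
    by (simp add: power_mult_distrib flip: power_mult of_real_power)
      (simp add: mult.commute)
  then show ?thesis
    by (simp only: power2_eq_iff)
qed

text \<open>The sign of the square root is irrelevant because the mean uses both roots. As
  \<open>csqrt v\<close> does not involve \<open>r\<close>, the roots for two different radii are
  paired with the same unit factors.\<close>

lemma dyadic_mean_Suc_radial:
  "dyadic_mean G (Suc m) (v * of_real (r ^ 2 ^ Suc m)) =
    (1/2) *\<^sub>R (dyadic_mean G m (csqrt v * of_real (r ^ 2 ^ m)) +
               dyadic_mean G m (- csqrt v * of_real (r ^ 2 ^ m)))"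
  using csqrt_mult_square[of v r m] by (auto simp: add.commute simp del: power_Suc)

lemma norm_dyadic_mean_le:
  assumes "\<And>v. cmod v = 1 \<Longrightarrow> norm (G (v * of_real r)) \<le> c" "cmod v = 1"
  shows "norm (dyadic_mean G m (v * of_real (r ^ 2 ^ m))) \<le> c"
  using assms(2)
proof (induction m arbitrary: v)
  case 0
  then show ?case using assms(1) by simp
next
  case (Suc m)
  show ?case
    unfolding dyadic_mean_Suc_radial by (intro norm_half_sum_le Suc.IH) (use Suc.prems in simp_all)
qed

lemma norm_dyadic_mean_diff_le:
  assumes "\<And>v. cmod v = 1 \<Longrightarrow> norm (G (v * of_real r) - G (v * of_real s)) \<le> c" "cmod v = 1"
  shows "norm (dyadic_mean G m (v * of_real (r ^ 2 ^ m)) - dyadic_mean G m (v * of_real (s ^ 2 ^ m))) \<le> c"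
  using assms(2)
proof (induction m arbitrary: v)
  case 0
  then show ?case using assms(1) by simp
next
  case (Suc m)
  have *: "(1/2) *\<^sub>R (a + b) - (1/2) *\<^sub>R (a' + b') = (1/2) *\<^sub>R ((a - a') + (b - b'))" for a b a' b' :: 'a
    by (simp add: algebra_simps)
  show ?case
    unfolding dyadic_mean_Suc_radial * by (intro norm_half_sum_le Suc.IH) (use Suc.prems in simp_all)
qed

lemma norm_idempotent_ge_1:
  fixes e :: "'a::real_normed_algebra"
  assumes "e * e = e" "e \<noteq> 0"
  shows "norm e \<ge> 1"
  using norm_mult_ineq[of e e] assms by simp

text \<open>Think of \<open>t\<close> as \<open>1/(1 - q) - 1\<close>. The constants close a loop:
  \<open>1/3\<close> for \<open>t\<close> gives \<open>1/2\<close> for \<open>q\<close>, and the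
  fourth power \<open>1/16\<close> gives \<open>1/6\<close>, which leaves room for an error of
  another \<open>1/6\<close>.\<close>

lemma norm_small_of_quasi_inverse:
  fixes t q :: "'a::real_normed_algebra"
  assumes "t = q + t * q"
  shows "norm t \<le> 1/3 \<Longrightarrow> norm q \<le> 1/2" "norm q \<le> 1/16 \<Longrightarrow> norm t \<le> 1/6"
proof -
  have *: "norm (t * q) \<le> norm t * norm q" by (rule norm_mult_ineq)
  {
    assume t: "norm t \<le> 1/3"
    have "norm t * norm q \<le> 1/3 * norm q" using t by (intro mult_right_mono) auto
    moreover have "q = t - t * q" using assms by (metis add_diff_cancel_right')
    then have "norm q \<le> norm t + norm (t * q)" by (metis norm_triangle_ineq4)
    ultimately show "norm q \<le> 1/2" using t * by linarith
  }
  {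
    assume q: "norm q \<le> 1/16"
    have "norm t * norm q \<le> norm t * (1/16)" using q by (intro mult_left_mono) auto
    moreover have "norm t \<le> norm q + norm (t * q)" by (metis assms norm_triangle_ineq)
    ultimately show "norm t \<le> 1/6" using q * by linarith
  }
qed

lemma scaleC_power:
  fixes x :: "'a::complex_banach_algebra"
  shows "(c *\<^sub>C x) ^ n = c ^ n *\<^sub>C x ^ n"
  by (induction n) (simp_all add: scaleC_one mult_scaleC_left mult_scaleC_right scaleC_scaleC)

text \<open>Here \<open>G z\<close> plays the role of \<open>(e - z x)\<^sup>-\<^sup>1\<close>, and \<open>x'\<close> of \<open>x\<^sup>-\<^sup>1\<close>, in the algebra \<open>e A e\<close>
  with identity \<open>e\<close>.\<close>

locale corner_resolvent =
  fixes e x x' :: "'a::complex_banach_algebra" and G :: "complex \<Rightarrow> 'a"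
  assumes e_idem: "e * e = e" and e_nonzero: "e \<noteq> 0"
    and ex: "e * x = x" and xe: "x * e = x"
    and eG: "\<And>z. e * G z = G z" and Ge: "\<And>z. G z * e = G z"
    and G_left: "\<And>z. G z * (e - z *\<^sub>C x) = e"
    and G_right: "\<And>z. (e - z *\<^sub>C x) * G z = e"
    and ex': "e * x' = x'" and xx': "x * x' = e"
begin

section \<open>Bounds and continuity of the resolvent\<close>

lemma G_zero: "G 0 = e"
  using G_left[of 0] Ge by simp

text \<open>The resolvent identity, obtained by sandwiching the difference of the two inverted
  elements between \<open>G z\<close> and \<open>G w\<close>.\<close>

lemma G_diff: "G z - G w = (z - w) *\<^sub>C (G z * x * G w)"
proof -
  have "G z * ((e - w *\<^sub>C x) - (e - z *\<^sub>C x)) * G w = G z - G w"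
    by (metis (no_types) G_left G_right Ge eG left_diff_distrib mult.assoc right_diff_distrib)
  moreover have "(e - w *\<^sub>C x) - (e - z *\<^sub>C x) = (z - w) *\<^sub>C x"
    by (simp add: complex_vector.scale_left_diff_distrib)
  ultimately show ?thesis
    by (simp add: mult_scaleC_left mult_scaleC_right)
qed

lemma norm_G_diff: "norm (G z - G w) \<le> cmod (z - w) * (norm (G z) * norm x * norm (G w))"
proof -
  have "norm (G z * x * G w) \<le> norm (G z) * norm x * norm (G w)"
    by (meson norm_mult_ineq order_trans mult_right_mono norm_ge_zero)
  then show ?thesis
    unfolding G_diff[of z w] norm_scaleC by (intro mult_left_mono) auto
qed

text \<open>Multiplying \<open>G_left\<close> by \<open>x'\<close> gives
  \<open>z *\<^sub>C G z = G z * x' - x'\<close>, so invertibility of \<open>x\<close> makes the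
  resolvent small far out. The factor 4 leaves 3 after one term is absorbed.\<close>

lemma norm_G_far:
  assumes "4 * norm x' \<le> cmod z"
  shows "norm (G z) \<le> 1/3"
proof -
  have x'0: "x' \<noteq> 0" using xx' e_nonzero by auto
  have "G z * (e - z *\<^sub>C x) * x' = G z * x' - z *\<^sub>C G z"
    by (simp add: mult.assoc left_diff_distrib right_diff_distrib ex' xx' Ge
        mult_scaleC_left mult_scaleC_right)
  then have "z *\<^sub>C G z = G z * x' - x'"
    using G_left ex' by (metis add_diff_cancel_left' diff_add_cancel diff_diff_eq2)
  then have "cmod z * norm (G z) \<le> norm (G z * x') + norm x'"
    by (metis norm_scaleC norm_triangle_ineq4)
  also have "\<dots> \<le> norm (G z) * norm x' + norm x'"
    using norm_mult_ineq by auto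
  finally have "cmod z * norm (G z) \<le> norm (G z) * norm x' + norm x'" .
  moreover have "4 * norm x' * norm (G z) \<le> cmod z * norm (G z)"
    using assms by (intro mult_right_mono) auto
  ultimately have "norm x' * (3 * norm (G z)) \<le> norm x' * 1"
    by (simp add: algebra_simps)
  then show ?thesis using x'0 by simp
qed

lemma continuous_G: "isCont G w"
proof -
  define c where "c = norm x * norm (G w)"
  have c0: "c \<ge> 0" by (simp add: c_def)
  have lim: "((\<lambda>z. cmod (z - w) * (c * (2 * norm (G w)))) \<longlongrightarrow> 0) (at w)"
    by (auto intro!: tendsto_eq_intros)
  have "((\<lambda>z. cmod (z - w) * c) \<longlongrightarrow> 0) (at w)"
    by (auto intro!: tendsto_eq_intros)
  \<comment> \<open>Close to \<open>w\<close>, this lets the unknown factor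
    \<open>norm (G z)\<close> in \<open>norm_G_diff\<close> be bounded by
    \<open>2 * norm (G w)\<close>.\<close>
  then have "eventually (\<lambda>z. cmod (z - w) * c < 1/2) (at w)"
    by (rule order_tendstoD) simp
  then have "eventually (\<lambda>z. norm (G z - G w) \<le> cmod (z - w) * (c * (2 * norm (G w)))) (at w)"
  proof eventually_elim
    case (elim z)
    have d: "norm (G z - G w) \<le> cmod (z - w) * c * norm (G z)"
      using norm_G_diff[of z w] by (simp add: c_def algebra_simps)
    also have "\<dots> \<le> 1/2 * norm (G z)"
      using elim by (intro mult_right_mono) auto
    finally have "norm (G z) \<le> 2 * norm (G w)"
      using norm_triangle_ineq2[of "G z" "G w"] by linarith
    then have "cmod (z - w) * c * norm (G z) \<le> cmod (z - w) * c * (2 * norm (G w))"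
      using c0 by (intro mult_left_mono) auto
    with d show ?case by (simp add: mult.assoc)
  qed
  then have "((\<lambda>z. G z - G w) \<longlongrightarrow> 0) (at w)"
    by (rule Lim_null_comparison[OF _ lim])
  then show ?thesis
    by (simp add: isCont_def LIM_zero_iff)
qed

lemma G_bounded: obtains M where "M > 0" "\<And>z. norm (G z) \<le> M"
proof -
  have "compact (G ` cball 0 (4 * norm x'))"
    by (intro compact_continuous_image continuous_at_imp_continuous_on compact_cball)
      (simp add: continuous_G)
  then obtain M where "\<And>z. cmod z \<le> 4 * norm x' \<Longrightarrow> norm (G z) \<le> M"
    by (force dest!: compact_imp_bounded simp: bounded_iff)
  then have "norm (G z) \<le> max M 1" for z
    using norm_G_far[of z] by (cases "cmod z \<le> 4 * norm x'") (force simp: le_max_iff_disj)+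
  then show ?thesis by (intro that[of "max M 1"]) auto
qed

lemma G_uniformly_continuous:
  obtains \<delta> where "\<delta> > 0" "\<And>z w. cmod (z - w) \<le> \<delta> \<Longrightarrow> norm (G z - G w) \<le> 1/6"
proof -
  obtain M where M: "M > 0" "\<And>z. norm (G z) \<le> M" using G_bounded by metis
  \<comment> \<open>A global Lipschitz constant for \<open>G\<close>; the added 1 makes it
    positive.\<close>
  define K where "K = M * norm x * M + 1"
  have K: "K > 0" using M by (auto simp: K_def intro!: add_nonneg_pos)
  have "norm (G z - G w) \<le> 1/6" if "cmod (z - w) \<le> 1 / (6 * K)" for z w
  proof -
    have "norm (G z) * norm x * norm (G w) \<le> M * norm x * M"
      using M by (intro mult_mono) auto
    then have "norm (G z) * norm x * norm (G w) \<le> K" by (simp add: K_def)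
    then have "cmod (z - w) * (norm (G z) * norm x * norm (G w)) \<le> 1 / (6 * K) * K"
      using that K by (intro mult_mono) auto
    also have "\<dots> = 1/6" using K by simp
    finally show ?thesis using norm_G_diff[of z w] by linarith
  qed
  then show ?thesis using K by (intro that[of "1 / (6 * K)"]) auto
qed

section \<open>Means of the resolvent and powers of \<open>x\<close>\<close>

lemma e_power:
  assumes "n > 0"
  shows "e * x ^ n = x ^ n" "x ^ n * e = x ^ n"
proof -
  obtain k where k: "n = Suc k" using assms by (cases n) auto
  show "e * x ^ n = x ^ n" by (simp add: k ex flip: mult.assoc)
  show "x ^ n * e = x ^ n" by (simp add: k xe mult.assoc power_Suc2 del: power_Suc)
qed

text \<open>Partial fractions: \<open>1/(1 - w y^2)\<close> is the average of
  \<open>1/(1 - z y)\<close> and \<open>1/(1 + z y)\<close> when \<open>z^2 = w\<close>, applied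
  with \<open>y = x ^ 2 ^ m\<close>.\<close>

lemma dyadic_mean_inverse: "dyadic_mean G m w * (e - w *\<^sub>C x ^ 2 ^ m) = e"
proof (induction m arbitrary: w)
  case 0
  then show ?case by (simp add: G_left)
next
  case (Suc m)
  define z y where "z = csqrt w" and "y = x ^ 2 ^ m"
  have ey: "e * y = y" "y * e = y" by (simp_all add: y_def e_power)
  have yy: "y * y = x ^ 2 ^ Suc m"
    by (simp add: y_def mult_2 flip: power_add)
  have zz: "z * z = w" by (simp add: z_def flip: power2_eq_square)
  have fact: "e - w *\<^sub>C x ^ 2 ^ Suc m = (e - z *\<^sub>C y) * (e + z *\<^sub>C y)"
    "e - w *\<^sub>C x ^ 2 ^ Suc m = (e - (- z) *\<^sub>C y) * (e - z *\<^sub>C y)"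
    by (simp_all add: algebra_simps ey e_idem mult_scaleC_left mult_scaleC_right scaleC_scaleC zz yy
        del: power_Suc)
  have "dyadic_mean G m z * (e - w *\<^sub>C x ^ 2 ^ Suc m) = e + z *\<^sub>C y"
    unfolding fact(1) mult.assoc[symmetric] using Suc.IH[of z]
    by (simp add: distrib_left ey e_idem mult_scaleC_right flip: y_def)
  moreover have "dyadic_mean G m (- z) * (e - w *\<^sub>C x ^ 2 ^ Suc m) = e - z *\<^sub>C y"
    unfolding fact(2) mult.assoc[symmetric] using Suc.IH[of "- z"]
    by (simp add: right_diff_distrib ey e_idem mult_scaleC_right flip: y_def del: complex_vector.scale_minus_left)
  ultimately have "dyadic_mean G (Suc m) w * (e - w *\<^sub>C x ^ 2 ^ Suc m)
      = (1/2) *\<^sub>R ((e + z *\<^sub>C y) + (e - z *\<^sub>C y))"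
    by (simp add: distrib_right flip: z_def del: power_Suc)
  also have "\<dots> = e" by (simp flip: scaleR_2)
  finally show ?case .
qed

lemma dyadic_mean_corner: "dyadic_mean G m w * e = dyadic_mean G m w"
  by (induction m arbitrary: w) (simp_all add: Ge distrib_right)

lemma dyadic_mean_quasi_inverse:
  fixes w m
  defines "t \<equiv> dyadic_mean G m w - e" and "q \<equiv> w *\<^sub>C x ^ 2 ^ m"
  shows "t = q + t * q"
proof -
  have "e * q = q" by (simp add: q_def mult_scaleC_right e_power)
  then show ?thesis
    using dyadic_mean_inverse[of m w]
    by (simp add: t_def q_def right_diff_distrib left_diff_distrib dyadic_mean_corner algebra_simps)
qed

text \<open>Closeness of the mean to \<open>e\<close> says that a power of \<open>r x\<close> is small; two more squarings
  make it even smaller.\<close>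

lemma dyadic_mean_improve:
  assumes "norm (dyadic_mean G m (of_real (r ^ 2 ^ m)) - e) \<le> 1/3"
  shows "norm (dyadic_mean G (m + 2) (of_real (r ^ 2 ^ (m + 2))) - e) \<le> 1/6"
proof -
  define q where "q = (complex_of_real r *\<^sub>C x) ^ 2 ^ m"
  have "norm q \<le> 1/2"
    using norm_small_of_quasi_inverse(1)[OF dyadic_mean_quasi_inverse assms]
    by (simp add: q_def scaleC_power)
  moreover have "(complex_of_real r *\<^sub>C x) ^ 2 ^ (m + 2) = q ^ 4"
    by (simp add: q_def mult.commute flip: power_mult)
  moreover have "norm (q ^ 4) \<le> norm q ^ 4"
  proof -
    have *: "norm (p * p) \<le> (norm p)\<^sup>2" for p :: 'a
      using norm_mult_ineq[of p p] by (simp add: power2_eq_square)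
    have "q ^ 4 = (q * q) * (q * q)" by (simp add: numeral_eq_Suc mult.assoc)
    then have "norm (q ^ 4) \<le> (norm (q * q))\<^sup>2" using *[of "q * q"] by simp
    also have "\<dots> \<le> ((norm q)\<^sup>2)\<^sup>2" using *[of q] by (intro power_mono) auto
    finally show ?thesis by simp
  qed
  moreover have "norm q ^ 4 \<le> (1/2) ^ 4" if "norm q \<le> 1/2"
    using that by (intro power_mono) auto
  ultimately have "norm ((complex_of_real r *\<^sub>C x) ^ 2 ^ (m + 2)) \<le> 1/16"
    by (simp add: power_divide)
  then show ?thesis
    by (intro norm_small_of_quasi_inverse(2)[OF dyadic_mean_quasi_inverse])
      (simp add: scaleC_power)
qed

text \<open>The radius grows from 0 in steps of \<open>\<delta>\<close>. Each step moves every mean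
  by at most \<open>1/6\<close>, and raising \<open>m\<close> by 2 first brings the distance from
  \<open>e\<close> down to \<open>1/6\<close>; so at each radius some mean stays within
  \<open>1/3\<close> of \<open>e\<close>. Far out all means have norm at most \<open>1/3\<close>,
  forcing \<open>norm e \<le> 2/3\<close>.\<close>

lemma contradiction: False
proof -
  obtain \<delta> where \<delta>: "\<delta> > 0" "\<And>z w. cmod (z - w) \<le> \<delta> \<Longrightarrow> norm (G z - G w) \<le> 1/6"
    using G_uniformly_continuous by metis
  have close: "\<exists>m. norm (dyadic_mean G m (of_real ((j * \<delta>) ^ 2 ^ m)) - e) \<le> 1/3" for j :: nat
  proof (induction j)
    case 0
    have "norm (dyadic_mean G 0 (of_real ((0 * \<delta>) ^ 2 ^ 0)) - e) \<le> 1/3"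
      by (simp add: G_zero)
    then show ?case by (metis of_nat_0)
  next
    case (Suc j)
    then obtain m where "norm (dyadic_mean G m (of_real ((j * \<delta>) ^ 2 ^ m)) - e) \<le> 1/3" by blast
    note near = dyadic_mean_improve[OF this]
    let ?f = "\<lambda>r. dyadic_mean G (m + 2) (complex_of_real (r ^ 2 ^ (m + 2)))"
    have "norm (G (v * of_real (Suc j * \<delta>)) - G (v * of_real (j * \<delta>))) \<le> 1/6" if "cmod v = 1" for v
    proof (rule \<delta>)
      have "v * of_real (Suc j * \<delta>) - v * of_real (j * \<delta>) = v * of_real \<delta>"
        by (simp add: algebra_simps)
      then show "cmod (v * of_real (Suc j * \<delta>) - v * of_real (j * \<delta>)) \<le> \<delta>"
        using that \<delta>(1) by (simp only: norm_mult) simp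
    qed
    \<comment> \<open>The bound is the same for all \<open>m\<close>, so the fixed step
      \<open>\<delta>\<close> works although \<open>m\<close> grows with \<open>j\<close>.\<close>
    from norm_dyadic_mean_diff_le[OF this norm_one, of "m + 2"]
    have "norm (?f (Suc j * \<delta>) - ?f (j * \<delta>)) \<le> 1/6" by (simp only: mult_1_left)
    moreover have "norm (?f (Suc j * \<delta>) - e) \<le> norm (?f (Suc j * \<delta>) - ?f (j * \<delta>)) + norm (?f (j * \<delta>) - e)"
      by (rule dist_triangle[where 'a = 'a, unfolded dist_norm])
    ultimately have "norm (?f (Suc j * \<delta>) - e) \<le> 1/3" using near by linarith
    then show ?case by blast
  qed
  obtain j :: nat where j: "4 * norm x' < j * \<delta>"
    using \<delta>(1) reals_Archimedean3 by blast
  obtain m where m: "norm (dyadic_mean G m (of_real ((j * \<delta>) ^ 2 ^ m)) - e) \<le> 1/3"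
    using close by blast
  have "norm (G (v * of_real (j * \<delta>))) \<le> 1/3" if "cmod v = 1" for v
    using that j \<delta>(1) by (intro norm_G_far) (simp add: norm_mult)
  from norm_dyadic_mean_le[where G = G and r = "j * \<delta>" and v = 1 and m = m, OF this norm_one]
  have "norm (dyadic_mean G m (of_real ((j * \<delta>) ^ 2 ^ m))) \<le> 1/3" by (simp only: mult_1_left)
  then have "norm e \<le> 1/3 + 1/3"
    using m by (intro order_trans[OF norm_triangle_sub[of e]] add_mono)
      (simp_all only: norm_minus_commute)
  then show False
    using norm_idempotent_ge_1[OF e_idem e_nonzero] by simp
qed

end

text \<open>If \<open>x\<close> is no multiple of \<open>e\<close>, then neither \<open>x\<close>
  nor any \<open>e - z *\<^sub>C x\<close> vanishes. All are thus invertible in the corner, which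
  yields a resolvent on the whole plane.\<close>

lemma gelfand_mazur_corner:
  fixes e x :: "'a::complex_banach_algebra"
  assumes e: "e * e = e" "e \<noteq> 0" and x: "e * x = x" "x * e = x"
    and inv: "\<And>y. e * y = y \<Longrightarrow> y * e = y \<Longrightarrow> y \<noteq> 0 \<Longrightarrow>
      \<exists>u. e * u = u \<and> u * e = u \<and> u * y = e \<and> y * u = e"
  shows "\<exists>c. x = c *\<^sub>C e"
proof (rule ccontr)
  assume neg: "\<nexists>c. x = c *\<^sub>C e"
  have "e - z *\<^sub>C x \<noteq> 0" for z
  proof
    assume *: "e - z *\<^sub>C x = 0"
    with e have "z \<noteq> 0" by auto
    from * have "inverse z *\<^sub>C e = inverse z *\<^sub>C z *\<^sub>C x" by simp
    with \<open>z \<noteq> 0\<close> have "x = inverse z *\<^sub>C e" by (simp add: scaleC_scaleC scaleC_one)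
    with neg show False by blast
  qed
  moreover have "e * (e - z *\<^sub>C x) = e - z *\<^sub>C x" "(e - z *\<^sub>C x) * e = e - z *\<^sub>C x" for z
    by (simp_all add: right_diff_distrib left_diff_distrib e x mult_scaleC_left mult_scaleC_right)
  ultimately have "\<exists>u. e * u = u \<and> u * e = u \<and> u * (e - z *\<^sub>C x) = e \<and> (e - z *\<^sub>C x) * u = e" for z
    by (intro inv)
  then obtain G where G: "\<And>z. e * G z = G z" "\<And>z. G z * e = G z"
    "\<And>z. G z * (e - z *\<^sub>C x) = e" "\<And>z. (e - z *\<^sub>C x) * G z = e"
    by metis
  have "x \<noteq> 0" using neg complex_vector.scale_zero_left by metis
  then obtain x' where x': "e * x' = x'" "x * x' = e"
    using inv x by blast
  interpret corner_resolvent e x x' G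
    by unfold_locales (fact e x G x')+
  show False by (rule contradiction)
qed

section \<open>Left ideals and the radical\<close>

lemma left_idealD:
  assumes "left_ideal L"
  shows "0 \<in> L" "x \<in> L \<Longrightarrow> y \<in> L \<Longrightarrow> x + y \<in> L" "x \<in> L \<Longrightarrow> y \<in> L \<Longrightarrow> x - y \<in> L"
    "x \<in> L \<Longrightarrow> a * x \<in> L"
  using assms complex_vector.subspace_diff complex_vector.subspace_0 complex_vector.subspace_add
  unfolding left_ideal_def by auto

text \<open>Closure under complex scalars is automatic in a unital algebra: scaling by
  \<open>c\<close> is left multiplication by \<open>c *\<^sub>C 1\<close>.\<close>

lemma left_idealI:
  fixes L :: "'a::complex_banach_algebra set"
  assumes "0 \<in> L" "\<And>x y. x \<in> L \<Longrightarrow> y \<in> L \<Longrightarrow> x + y \<in> L" "\<And>a x. x \<in> L \<Longrightarrow> a * x \<in> L"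
  shows "left_ideal L"
proof -
  have "c *\<^sub>C x \<in> L" if "x \<in> L" for c x
    using assms(3)[OF that, of "c *\<^sub>C 1"] by (simp add: mult_scaleC_left)
  then show ?thesis
    using assms by (auto simp: left_ideal_def complex_vector.subspace_def)
qed

text \<open>If a maximal left ideal \<open>M\<close> misses \<open>y\<close>, then
  \<open>M + A y\<close> is everything and \<open>1 = m + a * y\<close>. Left multiplication by
  \<open>y\<close> kills the second term, so \<open>y = y * m\<close> lies in \<open>M\<close> after
  all.\<close>

lemma semisimple_imp_semiprime:
  fixes y :: "'a::complex_banach_algebra"
  assumes "semisimple TYPE('a)" and y: "\<And>b. y * b * y = 0"
  shows "y = 0"
proof -
  have "y \<in> M" if M: "maximal_left_ideal M" for M
  proof (rule ccontr)
    assume "y \<notin> M"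
    have li: "left_ideal M" using M by (simp add: maximal_left_ideal_def)
    define J where "J = {m + a * y | m a. m \<in> M}"
    have "left_ideal J"
    proof (rule left_idealI)
      have "0 = 0 + 0 * y" by simp
      then show "0 \<in> J" using left_idealD(1)[OF li] unfolding J_def by blast
    next
      fix u v assume "u \<in> J" "v \<in> J"
      then obtain m a n b where "u = m + a * y" "v = n + b * y" "m \<in> M" "n \<in> M"
        unfolding J_def by blast
      then have "u + v = (m + n) + (a + b) * y" "m + n \<in> M"
        using left_idealD(2)[OF li] by (simp_all add: algebra_simps)
      then show "u + v \<in> J" unfolding J_def by blast
    next
      fix b u assume "u \<in> J"
      then obtain m a where "u = m + a * y" "m \<in> M"
        unfolding J_def by blast
      then have "b * u = b * m + (b * a) * y" "b * m \<in> M"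
        using left_idealD(4)[OF li] by (simp_all add: algebra_simps)
      then show "b * u \<in> J" unfolding J_def by blast
    qed
    moreover have "M \<subseteq> J"
    proof
      fix m assume "m \<in> M"
      moreover have "m = m + 0 * y" by simp
      ultimately show "m \<in> J" unfolding J_def by blast
    qed
    moreover have "y \<in> J"
    proof -
      have "y = 0 + 1 * y" by simp
      then show ?thesis using left_idealD(1)[OF li] unfolding J_def by blast
    qed
    ultimately have "J = UNIV"
      using M \<open>y \<notin> M\<close> unfolding maximal_left_ideal_def by blast
    then obtain m a where ma: "1 = m + a * y" "m \<in> M"
      unfolding J_def by blast
    have "y * m = y * (m + a * y)"
      using y[of a] by (simp add: distrib_left mult.assoc)
    then have "y = y * m"
      by (simp flip: ma(1))
    then show False
      using left_idealD(4)[OF li ma(2), of y] \<open>y \<notin> M\<close> by simp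
  qed
  then show ?thesis
    using assms(1) by (auto simp: semisimple_def jacobson_radical_def)
qed

section \<open>Minimal left ideals\<close>

lemma minimal_left_ideal_subset_socle:
  assumes "minimal_left_ideal L"
  shows "L \<subseteq> socle"
proof
  fix x assume "x \<in> L"
  then have "x = (\<Sum>L\<in>{L}. x) \<and> finite {L} \<and> (\<forall>L\<in>{L}. minimal_left_ideal L \<and> x \<in> L)"
    using assms by simp
  then show "x \<in> socle"
    unfolding socle_def by (intro CollectI exI[of _ "{L}"] exI[of _ "\<lambda>_. x"]) simp
qed

lemma socle_subset_center:
  assumes "\<And>L :: 'a::complex_banach_algebra set. minimal_left_ideal L \<Longrightarrow> L \<subseteq> algebra_center"
  shows "socle \<subseteq> (algebra_center :: 'a set)"
proof
  fix x :: 'a assume "x \<in> socle"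
  then obtain F f where x: "x = (\<Sum>L\<in>F. f L)" and F: "\<forall>L\<in>F. minimal_left_ideal L \<and> f L \<in> L"
    unfolding socle_def by blast
  have "f L \<in> algebra_center" if "L \<in> F" for L
    using F assms[of L] that by blast
  then have "x * y = y * x" for y
    unfolding x sum_distrib_left sum_distrib_right
    by (intro sum.cong refl) (simp add: algebra_center_def)
  then show "x \<in> algebra_center"
    by (simp add: algebra_center_def)
qed

text \<open>As in Schur's lemma, right multiplication by \<open>z\<close> is zero or injective on
  \<open>L\<close>, since its kernel there is a left ideal.\<close>

lemma minimal_left_ideal_annihilator:
  assumes L: "minimal_left_ideal L" and "x \<in> L" "x * z \<noteq> 0" "y \<in> L" "y * z = 0"
  shows "y = 0"
proof -
  have li: "left_ideal L" using L by (simp add: minimal_left_ideal_def)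
  have "left_ideal {y \<in> L. y * z = 0}"
    by (rule left_idealI) (auto simp: left_idealD[OF li] distrib_right mult.assoc)
  then have "{y \<in> L. y * z = 0} = {0} \<or> {y \<in> L. y * z = 0} = L"
    using L unfolding minimal_left_ideal_def by blast
  then show ?thesis using assms by blast
qed

lemma minimal_left_ideal_generator:
  assumes L: "minimal_left_ideal L" and "y \<in> L" "y \<noteq> 0" "x \<in> L"
  obtains a where "x = a * y"
proof -
  have li: "left_ideal L" using L by (simp add: minimal_left_ideal_def)
  have "left_ideal (range (\<lambda>a. a * y))"
  proof (rule left_idealI)
    show "0 \<in> range (\<lambda>a. a * y)" by (metis mult_zero_left rangeI)
    show "u + v \<in> range (\<lambda>a. a * y)" if "u \<in> range (\<lambda>a. a * y)" "v \<in> range (\<lambda>a. a * y)" for u v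
      using that by (auto simp flip: distrib_right)
    show "b * u \<in> range (\<lambda>a. a * y)" if "u \<in> range (\<lambda>a. a * y)" for b u
      using that by (auto simp flip: mult.assoc)
  qed
  moreover have "range (\<lambda>a. a * y) \<subseteq> L" using assms(2) left_idealD(4)[OF li] by auto
  moreover have "y \<in> range (\<lambda>a. a * y)" by (metis mult_1 rangeI)
  ultimately have "range (\<lambda>a. a * y) = L"
    using L assms(3) unfolding minimal_left_ideal_def by blast
  then show ?thesis using that assms(4) by blast
qed

text \<open>Brauer's lemma. Right multiplication by \<open>x\<close> is injective on
  \<open>L\<close> and kills \<open>e * e - e\<close>; right multiplication by \<open>e\<close> is
  then injective too and kills \<open>y * e - y\<close>.\<close>

lemma minimal_left_ideal_idempotent:
  assumes L: "minimal_left_ideal L" and "x \<in> L" "x * x \<noteq> 0"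
  obtains e where "e \<in> L" "e * e = e" "e \<noteq> 0" "\<And>y. y \<in> L \<Longrightarrow> y * e = y"
proof -
  have li: "left_ideal L" using L by (simp add: minimal_left_ideal_def)
  have "x * x \<in> L" using assms left_idealD(4)[OF li] by blast
  then obtain a where a: "x = a * (x * x)"
    using minimal_left_ideal_generator[OF L _ assms(3,2)] by metis
  define e where "e = a * x"
  have e: "e \<in> L" "e * x = x" "x \<noteq> 0"
    using assms left_idealD(4)[OF li] a by (auto simp: e_def mult.assoc)
  have "e * e - e \<in> L" using e left_idealD[OF li] by blast
  moreover have "(e * e - e) * x = 0" using e by (simp add: left_diff_distrib mult.assoc)
  ultimately have "e * e - e = 0"
    by (rule minimal_left_ideal_annihilator[OF L assms(2,3)])
  then have ee: "e * e = e" by simp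
  have e0: "e \<noteq> 0" using e by auto
  have "y * e = y" if "y \<in> L" for y
  proof -
    have "y * e - y \<in> L" using e that left_idealD[OF li] by blast
    moreover have "(y * e - y) * e = 0" by (simp add: left_diff_distrib mult.assoc ee)
    ultimately show ?thesis
      using minimal_left_ideal_annihilator[OF L e(1), of e "y * e - y"] ee e0 by auto
  qed
  with e ee e0 that show ?thesis by blast
qed

section \<open>Minimal left ideals without square-zero elements\<close>

lemma reduced_minimal_left_ideal_central:
  fixes L :: "'a::complex_banach_algebra set"
  assumes ss: "semisimple TYPE('a)" and L: "minimal_left_ideal L"
    and reduced: "\<And>x. x \<in> L \<Longrightarrow> x * x = 0 \<Longrightarrow> x = 0"
  shows "L \<subseteq> algebra_center"
proof
  fix x assume "x \<in> L"
  have li: "left_ideal L" using L by (simp add: minimal_left_ideal_def)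
  obtain x0 where "x0 \<in> L" "x0 \<noteq> 0"
    using L left_idealD(1)[OF li] unfolding minimal_left_ideal_def by blast
  then have "x0 * x0 \<noteq> 0" using reduced by blast
  then obtain e where e: "e \<in> L" "e * e = e" "e \<noteq> 0" "\<And>y. y \<in> L \<Longrightarrow> y * e = y"
    using minimal_left_ideal_idempotent[OF L \<open>x0 \<in> L\<close>] by blast
  have ae: "e * a * e = a * e" for a
  proof -
    let ?y = "a * e - e * (a * e)"
    have "?y \<in> L" by (intro left_idealD(3,4)[OF li] e(1))
    moreover have ey: "e * ?y = 0" by (simp add: right_diff_distrib e(2) flip: mult.assoc)
    have "?y * ?y = (a - e * a) * (e * ?y)"
      by (simp only: left_diff_distrib mult.assoc)
    then have "?y * ?y = 0" by (simp only: ey mult_zero_right)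
    ultimately have "?y = 0" by (rule reduced)
    then show ?thesis by (simp add: mult.assoc)
  qed
  have ea: "e * a * e = e * a" for a
  proof -
    define y where "y = e * a - e * a * e"
    have ye: "y * e = 0" by (simp add: y_def left_diff_distrib e(2) mult.assoc)
    have ey: "e * y = y" by (simp add: y_def right_diff_distrib e(2) flip: mult.assoc)
    \<comment> \<open>Here \<open>y\<close> is \<open>e a (1 - e)\<close>. Writing the right-hand
      \<open>y\<close> as \<open>e * y\<close> allows \<open>b * e\<close> to be replaced by
      \<open>e * b * e\<close>, which puts an \<open>e\<close> next to the left-hand
      \<open>y\<close>.\<close>
    have "y * b * y = 0" for b
    proof -
      have "y * b * y = y * (b * e) * y" by (simp only: mult.assoc ey)
      also have "\<dots> = y * (e * b * e) * y" by (simp only: ae)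
      also have "\<dots> = (y * e) * b * (e * y)" by (simp only: mult.assoc)
      finally show ?thesis by (simp only: ye mult_zero_left)
    qed
    then have "y = 0" by (rule semisimple_imp_semiprime[OF ss])
    then show ?thesis by (simp add: y_def)
  qed
  have left_inv: "\<exists>u. e * u = u \<and> u * e = u \<and> u * y = e" if y: "e * y = y" "y * e = y" "y \<noteq> 0" for y
  proof -
    have "y \<in> L" using left_idealD(4)[OF li e(1), of y] by (simp only: y)
    \<comment> \<open>Minimality gives a left inverse \<open>a\<close> of \<open>y\<close> relative
      to \<open>e\<close>; \<open>e * a\<close> moves it into the corner, by
      \<open>ea\<close>.\<close>
    then obtain a where a: "e = a * y" by (rule minimal_left_ideal_generator[OF L _ y(3) e(1)])
    have "e * (e * a) = e * a" by (simp only: e(2) flip: mult.assoc)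
    moreover have "e * a * y = e" by (simp only: mult.assoc e(2) flip: a)
    ultimately show ?thesis using ea[of a] by blast
  qed
  have "\<exists>u. e * u = u \<and> u * e = u \<and> u * y = e \<and> y * u = e"
    if y: "e * y = y" "y * e = y" "y \<noteq> 0" for y
  proof -
    obtain u where u: "e * u = u" "u * e = u" "u * y = e" using left_inv[OF y] by blast
    then have "u \<noteq> 0" using e(3) by auto
    then obtain v where v: "e * v = v" "v * e = v" "v * u = e" using left_inv[OF u(1,2)] by blast
    \<comment> \<open>The left inverse \<open>u\<close> has a left inverse \<open>v\<close> itself,
      and \<open>v\<close> must equal \<open>y\<close>; hence \<open>u\<close> is two-sided.\<close>
    have "v = v * (u * y)" by (simp only: u v)
    also have "\<dots> = y" by (simp only: v y flip: mult.assoc)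
    finally show ?thesis using u v by blast
  qed
  moreover have "x * e = x" by (rule e(4)[OF \<open>x \<in> L\<close>])
  moreover from this have "e * x = x" using ae[of x] by (simp add: mult.assoc)
  ultimately obtain c where c: "x = c *\<^sub>C e"
    using gelfand_mazur_corner[OF e(2,3), of x] by blast
  have "e * b = b * e" for b using ae[of b] ea[of b] by simp
  then show "x \<in> algebra_center"
    by (simp add: algebra_center_def c mult_scaleC_left mult_scaleC_right)
qed

theorem theorem5p4:
  assumes "semisimple TYPE('a::complex_banach_algebra)"
    and "(socle :: 'a set) \<noteq> {0}"
  shows "(socle :: 'a set) \<subseteq> algebra_center \<longleftrightarrow>
    (\<forall>x\<in>(socle :: 'a set). x\<^sup>2 = 0 \<longrightarrow> x = 0)"
proof (intro iffI ballI impI)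
  fix x :: 'a
  assume "socle \<subseteq> (algebra_center :: 'a set)" "x \<in> socle" "x\<^sup>2 = 0"
  then have "x * b * x = 0" for b
    by (auto simp: algebra_center_def subset_iff mult.assoc power2_eq_square)
  then show "x = 0"
    by (rule semisimple_imp_semiprime[OF assms(1)])
next
  assume reduced: "\<forall>x\<in>(socle :: 'a set). x\<^sup>2 = 0 \<longrightarrow> x = 0"
  have "L \<subseteq> algebra_center" if L: "minimal_left_ideal L" for L :: "'a set"
    using reduced minimal_left_ideal_subset_socle[OF L]
    by (intro reduced_minimal_left_ideal_central[OF assms(1) L]) (auto simp: power2_eq_square)
  then show "socle \<subseteq> (algebra_center :: 'a set)"
    by (rule socle_subset_center)
qed

end
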